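(* Let $E$ be a Banach space and let $\mathcal{A}=(A_n)_{n\in\mathbb{N}}$ be a sequence of bounded linear operators on $E$ (not necessarily invertible) with $\mathcal{E}_{ad}(\mathcal{A})\neq\emptyset$. Then $\mathcal{A}$ is nonuniform exponentially stable if and only if there exists an admissible exponent $\alpha\in\mathcal{E}_{ad}(\mathcal{A})$ for which the operator $G_\alpha$ is invertible on $c_{00}(\alpha)$.
   Context: $\mathbb{N}=\{0,1,2,\ldots\}$, $\Delta=\{(m,n)\in\mathbb{N}\times\mathbb{N}: m\geq n\}$. For $(m,n)\in\Delta$ put $A(m,n)=A_{m-1}\cdots A_n$ if $m>n$ and $A(n,n)=\mathrm{Id}$. A real number $\alpha$ is an admissible exponent for $\mathcal{A}$ if there is a (not necessarily bounded) positive real sequence $(M_n)_{n\in\mathbb{N}}$ with $\|A(m,n)\|\leq M_n e^{\alpha(m-n)}$ for all $(m,n)\in\Delta$. $\mathcal{E}_{ad}(\mathcal{A})$ is the set of all admissible exponents of $\mathcal{A}$. $\mathcal{A}$ is called nonuniform exponentially stable if it has a negative admissible exponent. For $\alpha\in\mathcal{E}_{ad}(\mathcal{A})$ and $n\in\mathbb{N}$, $\|x\|_{n,\alpha}=\sup_{m\geq n}e^{-\alpha(m-n)}\|A(m,n)x\|$, $x\in E$; this is a norm on $E$ with $\|x\|\leq\|x\|_{n,\alpha}\leq M_n\|x\|$. The space $c_{00}(\alpha)$ is the set of sequences $u=(u_n)_{n\in\mathbb{N}}$ in $E$ with $u_0=0$ and $\lim_{n\to\infty}\|u_n\|_{n,\alpha}=0$;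 it is a Banach space with norm $\|u\|_\alpha=\sup_{n\in\mathbb{N}}\|u_n\|_{n,\alpha}$. The evolution map $T$ acts on $E$-valued sequences by $(Tu)_0=0$ and $(Tu)_n=A_{n-1}u_{n-1}$ for $n\geq1$. $T_\alpha$ is its restriction to $c_{00}(\alpha)$, which is a bounded linear operator $c_{00}(\alpha)\to c_{00}(\alpha)$, and $G_\alpha=T_\alpha-\mathrm{Id}$ on $c_{00}(\alpha)$. *)

theory Defs
  imports "HOL-Analysis.Analysis"
begin

text \<open>
  \<open>evol A m n\<close> is \<open>A(m,n) = A\<^bsub>m-1\<^esub> \<cdots> A\<^bsub>n\<^esub>\<close>. It is meant for \<open>m \<ge> n\<close> only; the value
  \<open>id_blinfun\<close> for \<open>m < n\<close> is never used below.
\<close>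
fun evol :: "(nat \<Rightarrow> 'a::real_normed_vector \<Rightarrow>\<^sub>L 'a) \<Rightarrow> nat \<Rightarrow> nat \<Rightarrow> ('a \<Rightarrow>\<^sub>L 'a)" where
  "evol A 0 n = id_blinfun"
| "evol A (Suc m) n = (if n \<le> m then A m o\<^sub>L evol A m n else id_blinfun)"

definition admissible_exponents :: "(nat \<Rightarrow> 'a::real_normed_vector \<Rightarrow>\<^sub>L 'a) \<Rightarrow> real set" where
  "admissible_exponents A = {\<alpha>. \<exists>M :: nat \<Rightarrow> real. (\<forall>n. M n > 0) \<and>
     (\<forall>m n. n \<le> m \<longrightarrow> norm (evol A m n) \<le> M n * exp (\<alpha> * (real m - real n)))}"

definition nonuniform_exp_stable :: "(nat \<Rightarrow> 'a::real_normed_vector \<Rightarrow>\<^sub>L 'a) \<Rightarrow> bool" where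
  "nonuniform_exp_stable A \<longleftrightarrow> (\<exists>\<alpha>\<in>admissible_exponents A. \<alpha> < 0)"

text \<open>
  The norm \<open>\<parallel>x\<parallel>\<^bsub>n,\<alpha>\<^esub>\<close>. The supremum is taken in \<open>real\<close>, so the definition is meaningful
  only if the set is bounded above; this is the case for admissible \<open>\<alpha>\<close>
  (lemma \<open>bdd_above_lyap_norm\<close>). The same applies to \<open>c00_norm\<close> on \<open>c00\<close>
  (lemma \<open>bdd_above_c00_norm\<close>).
\<close>
definition lyap_norm :: "(nat \<Rightarrow> 'a::real_normed_vector \<Rightarrow>\<^sub>L 'a) \<Rightarrow> real \<Rightarrow> nat \<Rightarrow> 'a \<Rightarrow> real" where
  "lyap_norm A \<alpha> n x =
     (SUP m\<in>{n..}. exp (- \<alpha> * (real m - real n)) * norm (blinfun_apply (evol A m n) x))"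

definition c00 :: "(nat \<Rightarrow> 'a::real_normed_vector \<Rightarrow>\<^sub>L 'a) \<Rightarrow> real \<Rightarrow> (nat \<Rightarrow> 'a) set" where
  "c00 A \<alpha> = {u. u 0 = 0 \<and> (\<lambda>n. lyap_norm A \<alpha> n (u n)) \<longlonglongrightarrow> 0}"

definition c00_norm :: "(nat \<Rightarrow> 'a::real_normed_vector \<Rightarrow>\<^sub>L 'a) \<Rightarrow> real \<Rightarrow> (nat \<Rightarrow> 'a) \<Rightarrow> real" where
  "c00_norm A \<alpha> u = (SUP n. lyap_norm A \<alpha> n (u n))"

definition evolution_map ::
    "(nat \<Rightarrow> 'a::real_normed_vector \<Rightarrow>\<^sub>L 'a) \<Rightarrow> (nat \<Rightarrow> 'a) \<Rightarrow> (nat \<Rightarrow> 'a)" where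
  "evolution_map A u = (\<lambda>n. if n = 0 then 0 else blinfun_apply (A (n - 1)) (u (n - 1)))"

definition T_op ::
    "(nat \<Rightarrow> 'a::real_normed_vector \<Rightarrow>\<^sub>L 'a) \<Rightarrow> real \<Rightarrow> (nat \<Rightarrow> 'a) \<Rightarrow> (nat \<Rightarrow> 'a)" where
  "T_op A \<alpha> = restrict (evolution_map A) (c00 A \<alpha>)"

definition G_op ::
    "(nat \<Rightarrow> 'a::real_normed_vector \<Rightarrow>\<^sub>L 'a) \<Rightarrow> real \<Rightarrow> (nat \<Rightarrow> 'a) \<Rightarrow> (nat \<Rightarrow> 'a)" where
  "G_op A \<alpha> = (\<lambda>u\<in>c00 A \<alpha>. \<lambda>n. T_op A \<alpha> u n - u n)"

text \<open>
  The space \<open>c00 A \<alpha>\<close> depends on \<open>A\<close> and \<open>\<alpha>\<close>, so it is handled as a carrier set \<open>V\<close> of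
  sequences with a norm \<open>N\<close> rather than as a type. An operator on it is a function whose
  values outside \<open>V\<close> are irrelevant.
\<close>
definition bounded_operator_on ::
    "(nat \<Rightarrow> 'a::real_vector) set \<Rightarrow> ((nat \<Rightarrow> 'a) \<Rightarrow> real) \<Rightarrow> ((nat \<Rightarrow> 'a) \<Rightarrow> (nat \<Rightarrow> 'a)) \<Rightarrow> bool" where
  "bounded_operator_on V N S \<longleftrightarrow>
     (\<forall>u\<in>V. S u \<in> V) \<and>
     (\<forall>u\<in>V. \<forall>v\<in>V. S (\<lambda>n. u n + v n) = (\<lambda>n. S u n + S v n)) \<and>
     (\<forall>c. \<forall>u\<in>V. S (\<lambda>n. c *\<^sub>R u n) = (\<lambda>n. c *\<^sub>R S u n)) \<and>
     (\<exists>K. \<forall>u\<in>V. N (S u) \<le> K * N u)"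

definition invertible_operator_on ::
    "(nat \<Rightarrow> 'a::real_vector) set \<Rightarrow> ((nat \<Rightarrow> 'a) \<Rightarrow> real) \<Rightarrow> ((nat \<Rightarrow> 'a) \<Rightarrow> (nat \<Rightarrow> 'a)) \<Rightarrow> bool" where
  "invertible_operator_on V N G \<longleftrightarrow>
     bounded_operator_on V N G \<and>
     (\<exists>S. bounded_operator_on V N S \<and> (\<forall>u\<in>V. S (G u) = u \<and> G (S u) = u))"

lemma evol_same [simp]: "evol A n n = id_blinfun"
  by (cases n) auto

lemma evol_right:
  assumes "n < m"
  shows "evol A m n = evol A m (Suc n) o\<^sub>L A n"
  using assms
proof (induction m)
  case (Suc m)
  show ?case
  proof (cases "n = m")
    case True
    then show ?thesis by (auto intro!: blinfun_eqI)
  next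
    case False
    with Suc show ?thesis by (auto intro!: blinfun_eqI)
  qed
qed simp

lemma lyap_term_le:
  assumes "norm (evol A m n) \<le> M * exp (\<alpha> * (real m - real n))"
  shows "exp (- \<alpha> * (real m - real n)) * norm (blinfun_apply (evol A m n) x) \<le> M * norm x"
proof -
  have "exp (- \<alpha> * (real m - real n)) * norm (blinfun_apply (evol A m n) x)
        \<le> exp (- \<alpha> * (real m - real n)) * ((M * exp (\<alpha> * (real m - real n))) * norm x)"
    by (intro mult_left_mono order_trans[OF norm_blinfun mult_right_mono[OF assms]]) auto
  also have "\<dots> = (exp (- \<alpha> * (real m - real n)) * exp (\<alpha> * (real m - real n))) * (M * norm x)"
    by (simp only: mult_ac)
  also have "\<dots> = M * norm x"
    by (simp add: exp_add[symmetric])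
  finally show ?thesis .
qed

lemma bdd_above_lyap_norm:
  assumes "\<alpha> \<in> admissible_exponents A"
  shows "bdd_above ((\<lambda>m. exp (- \<alpha> * (real m - real n)) * norm (blinfun_apply (evol A m n) x)) ` {n..})"
proof -
  obtain M where M: "\<And>m n. n \<le> m \<Longrightarrow> norm (evol A m n) \<le> M n * exp (\<alpha> * (real m - real n))"
    using assms unfolding admissible_exponents_def by auto
  show ?thesis
    by (rule bdd_aboveI2[where M = "M n * norm x"]) (use lyap_term_le[OF M] in auto)
qed

lemma lyap_term_le_lyap_norm:
  assumes "\<alpha> \<in> admissible_exponents A" "n \<le> m"
  shows "exp (- \<alpha> * (real m - real n)) * norm (blinfun_apply (evol A m n) x) \<le> lyap_norm A \<alpha> n x"
  unfolding lyap_norm_def using assms(2)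
  by (intro cSUP_upper bdd_above_lyap_norm assms(1)) auto

lemma lyap_norm_leI:
  assumes "\<And>m. n \<le> m \<Longrightarrow> exp (- \<alpha> * (real m - real n)) * norm (blinfun_apply (evol A m n) x) \<le> B"
  shows "lyap_norm A \<alpha> n x \<le> B"
  unfolding lyap_norm_def by (rule cSUP_least) (use assms in auto)

lemma norm_le_lyap_norm:
  assumes "\<alpha> \<in> admissible_exponents A"
  shows "norm x \<le> lyap_norm A \<alpha> n x"
  using lyap_term_le_lyap_norm[OF assms order_refl, of n x] by simp

lemma lyap_norm_triangle:
  assumes "\<alpha> \<in> admissible_exponents A"
  shows "lyap_norm A \<alpha> n (x + y) \<le> lyap_norm A \<alpha> n x + lyap_norm A \<alpha> n y"
proof (rule lyap_norm_leI)
  fix m assume m: "n \<le> m"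
  have "exp (- \<alpha> * (real m - real n)) * norm (blinfun_apply (evol A m n) (x + y))
     \<le> exp (- \<alpha> * (real m - real n)) * (norm (blinfun_apply (evol A m n) x) + norm (blinfun_apply (evol A m n) y))"
    by (intro mult_left_mono) (auto simp: blinfun.add_right norm_triangle_ineq)
  also have "\<dots> \<le> lyap_norm A \<alpha> n x + lyap_norm A \<alpha> n y"
    unfolding distrib_left by (intro add_mono lyap_term_le_lyap_norm assms m)
  finally show "exp (- \<alpha> * (real m - real n)) * norm (blinfun_apply (evol A m n) (x + y))
     \<le> lyap_norm A \<alpha> n x + lyap_norm A \<alpha> n y" .
qed

lemma lyap_norm_scaleR_le:
  assumes "\<alpha> \<in> admissible_exponents A"
  shows "lyap_norm A \<alpha> n (c *\<^sub>R x) \<le> \<bar>c\<bar> * lyap_norm A \<alpha> n x"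
proof (rule lyap_norm_leI)
  fix m assume m: "n \<le> m"
  have "\<bar>c\<bar> * (exp (- \<alpha> * (real m - real n)) * norm (blinfun_apply (evol A m n) x)) \<le> \<bar>c\<bar> * lyap_norm A \<alpha> n x"
    by (intro mult_left_mono lyap_term_le_lyap_norm assms m) auto
  then show "exp (- \<alpha> * (real m - real n)) * norm (blinfun_apply (evol A m n) (c *\<^sub>R x))
     \<le> \<bar>c\<bar> * lyap_norm A \<alpha> n x"
    by (simp add: blinfun.scaleR_right mult_ac)
qed

lemma lyap_norm_nonneg:
  "\<alpha> \<in> admissible_exponents A \<Longrightarrow> 0 \<le> lyap_norm A \<alpha> n x"
  using norm_le_lyap_norm[of \<alpha> A x n] norm_ge_zero[of x] by linarith

lemma lyap_norm_zero [simp]: "lyap_norm A \<alpha> n 0 = 0"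
  unfolding lyap_norm_def by simp

lemma lyap_norm_minus: "lyap_norm A \<alpha> n (- x) = lyap_norm A \<alpha> n x"
  unfolding lyap_norm_def by (simp add: blinfun.minus_right)

lemma lyap_norm_step:
  assumes "\<alpha> \<in> admissible_exponents A"
  shows "lyap_norm A \<alpha> (Suc n) (blinfun_apply (A n) x) \<le> exp \<alpha> * lyap_norm A \<alpha> n x"
proof (rule lyap_norm_leI)
  fix m assume m: "Suc n \<le> m"
  have "exp (- \<alpha> * (real m - real (Suc n))) = exp \<alpha> * exp (- \<alpha> * (real m - real n))"
    unfolding exp_add[symmetric] by (simp add: algebra_simps)
  moreover have "blinfun_apply (evol A m (Suc n)) (blinfun_apply (A n) x) = blinfun_apply (evol A m n) x"
    using evol_right[of n m A] m by simp
  moreover have "exp (- \<alpha> * (real m - real n)) * norm (blinfun_apply (evol A m n) x) \<le> lyap_norm A \<alpha> n x"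
    using m by (intro lyap_term_le_lyap_norm assms) auto
  ultimately show "exp (- \<alpha> * (real m - real (Suc n))) *
      norm (blinfun_apply (evol A m (Suc n)) (blinfun_apply (A n) x)) \<le> exp \<alpha> * lyap_norm A \<alpha> n x"
    by (simp add: mult.assoc)
qed

lemma bdd_above_c00_norm:
  assumes "u \<in> c00 A \<alpha>"
  shows "bdd_above (range (\<lambda>n. lyap_norm A \<alpha> n (u n)))"
proof -
  have "Bseq (\<lambda>n. lyap_norm A \<alpha> n (u n))"
    using assms unfolding c00_def by (auto intro: convergent_imp_Bseq convergentI)
  then show ?thesis by (rule Bseq_bdd_above)
qed

lemma tendsto_zero_squeeze:
  fixes f g :: "nat \<Rightarrow> real"
  assumes "g \<longlonglongrightarrow> 0" "\<And>n. 0 \<le> f n" "\<And>n. f n \<le> g n"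
  shows "f \<longlonglongrightarrow> 0"
  by (rule tendsto_sandwich[of "\<lambda>_. 0" f _ g]) (use assms in auto)

lemma c00_add:
  assumes \<alpha>: "\<alpha> \<in> admissible_exponents A" and "u \<in> c00 A \<alpha>" "v \<in> c00 A \<alpha>"
  shows "(\<lambda>n. u n + v n) \<in> c00 A \<alpha>"
proof -
  have "(\<lambda>n. lyap_norm A \<alpha> n (u n) + lyap_norm A \<alpha> n (v n)) \<longlonglongrightarrow> 0"
    using assms(2,3) unfolding c00_def by (intro tendsto_add_zero) auto
  then have "(\<lambda>n. lyap_norm A \<alpha> n (u n + v n)) \<longlonglongrightarrow> 0"
    by (rule tendsto_zero_squeeze) (simp_all add: lyap_norm_nonneg[OF \<alpha>] lyap_norm_triangle[OF \<alpha>])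
  then show ?thesis using assms(2,3) unfolding c00_def by simp
qed

lemma c00_scaleR:
  assumes \<alpha>: "\<alpha> \<in> admissible_exponents A" and "u \<in> c00 A \<alpha>"
  shows "(\<lambda>n. c *\<^sub>R u n) \<in> c00 A \<alpha>"
proof -
  have "(\<lambda>n. \<bar>c\<bar> * lyap_norm A \<alpha> n (u n)) \<longlonglongrightarrow> 0"
    using assms(2) unfolding c00_def by (intro tendsto_mult_right_zero) auto
  then have "(\<lambda>n. lyap_norm A \<alpha> n (c *\<^sub>R u n)) \<longlonglongrightarrow> 0"
    by (rule tendsto_zero_squeeze) (simp_all add: lyap_norm_nonneg[OF \<alpha>] lyap_norm_scaleR_le[OF \<alpha>])
  then show ?thesis using assms(2) unfolding c00_def by simp
qed

lemma lyap_norm_le_c00_norm: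
  "u \<in> c00 A \<alpha> \<Longrightarrow> lyap_norm A \<alpha> n (u n) \<le> c00_norm A \<alpha> u"
  unfolding c00_norm_def by (intro cSUP_upper bdd_above_c00_norm) auto

lemma c00_norm_leI: "(\<And>n. lyap_norm A \<alpha> n (u n) \<le> B) \<Longrightarrow> c00_norm A \<alpha> u \<le> B"
  unfolding c00_norm_def by (rule cSUP_least) auto

lemma evolution_map_c00:
  assumes \<alpha>: "\<alpha> \<in> admissible_exponents A" and u: "u \<in> c00 A \<alpha>"
  shows "evolution_map A u \<in> c00 A \<alpha>"
proof -
  have "(\<lambda>n. exp \<alpha> * lyap_norm A \<alpha> n (u n)) \<longlonglongrightarrow> 0"
    using u unfolding c00_def by (intro tendsto_mult_right_zero) auto
  then have "(\<lambda>n. lyap_norm A \<alpha> (Suc n) (evolution_map A u (Suc n))) \<longlonglongrightarrow> 0"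
    by (rule tendsto_zero_squeeze)
       (simp_all add: evolution_map_def lyap_norm_nonneg[OF \<alpha>] lyap_norm_step[OF \<alpha>])
  then have "(\<lambda>n. lyap_norm A \<alpha> n (evolution_map A u n)) \<longlonglongrightarrow> 0"
    by (subst (asm) filterlim_sequentially_Suc)
  then show ?thesis by (simp add: c00_def evolution_map_def)
qed

lemma lyap_norm_evolution_map_le:
  assumes \<alpha>: "\<alpha> \<in> admissible_exponents A" and u: "u \<in> c00 A \<alpha>"
  shows "lyap_norm A \<alpha> n (evolution_map A u n) \<le> exp \<alpha> * c00_norm A \<alpha> u"
proof (cases n)
  case 0
  have "0 \<le> c00_norm A \<alpha> u"
    using lyap_norm_le_c00_norm[OF u, of 0] lyap_norm_nonneg[OF \<alpha>, of 0 "u 0"] by linarith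
  then show ?thesis using 0 by (simp add: evolution_map_def)
next
  case (Suc k)
  have "lyap_norm A \<alpha> (Suc k) (blinfun_apply (A k) (u k)) \<le> exp \<alpha> * lyap_norm A \<alpha> k (u k)"
    by (rule lyap_norm_step[OF \<alpha>])
  also have "\<dots> \<le> exp \<alpha> * c00_norm A \<alpha> u"
    by (intro mult_left_mono lyap_norm_le_c00_norm u) auto
  finally show ?thesis using Suc by (simp add: evolution_map_def)
qed

lemma bounded_operator_T_op:
  assumes \<alpha>: "\<alpha> \<in> admissible_exponents A"
  shows "bounded_operator_on (c00 A \<alpha>) (c00_norm A \<alpha>) (T_op A \<alpha>)"
  unfolding bounded_operator_on_def
proof (intro conjI ballI allI exI)
  fix u assume u: "u \<in> c00 A \<alpha>"
  show "T_op A \<alpha> u \<in> c00 A \<alpha>"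
    using evolution_map_c00[OF \<alpha> u] u by (simp add: T_op_def)
  show "c00_norm A \<alpha> (T_op A \<alpha> u) \<le> exp \<alpha> * c00_norm A \<alpha> u"
    using u lyap_norm_evolution_map_le[OF \<alpha> u] by (auto simp: T_op_def intro!: c00_norm_leI)
  show "T_op A \<alpha> (\<lambda>n. c *\<^sub>R u n) = (\<lambda>n. c *\<^sub>R T_op A \<alpha> u n)" for c
    using u c00_scaleR[OF \<alpha> u, of c]
    by (auto simp: T_op_def evolution_map_def fun_eq_iff blinfun.scaleR_right)
  fix v assume v: "v \<in> c00 A \<alpha>"
  show "T_op A \<alpha> (\<lambda>n. u n + v n) = (\<lambda>n. T_op A \<alpha> u n + T_op A \<alpha> v n)"
    using u v c00_add[OF \<alpha> u v]
    by (auto simp: T_op_def evolution_map_def fun_eq_iff blinfun.add_right)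
qed

lemma bounded_operator_G_op:
  assumes \<alpha>: "\<alpha> \<in> admissible_exponents A"
  shows "bounded_operator_on (c00 A \<alpha>) (c00_norm A \<alpha>) (G_op A \<alpha>)"
  unfolding bounded_operator_on_def
proof (intro conjI ballI allI exI)
  note T = bounded_operator_T_op[OF \<alpha>, unfolded bounded_operator_on_def]
  fix u assume u: "u \<in> c00 A \<alpha>"
  have Tu: "T_op A \<alpha> u \<in> c00 A \<alpha>" using T u by blast
  show "G_op A \<alpha> u \<in> c00 A \<alpha>"
    using c00_add[OF \<alpha> Tu c00_scaleR[OF \<alpha> u, of "-1"]] u by (simp add: G_op_def)
  show "c00_norm A \<alpha> (G_op A \<alpha> u) \<le> (exp \<alpha> + 1) * c00_norm A \<alpha> u"
  proof (rule c00_norm_leI)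
    fix n
    have "lyap_norm A \<alpha> n (evolution_map A u n + - u n)
        \<le> lyap_norm A \<alpha> n (evolution_map A u n) + lyap_norm A \<alpha> n (u n)"
      using lyap_norm_triangle[OF \<alpha>] lyap_norm_minus by metis
    also have "\<dots> \<le> exp \<alpha> * c00_norm A \<alpha> u + c00_norm A \<alpha> u"
      by (intro add_mono lyap_norm_evolution_map_le lyap_norm_le_c00_norm \<alpha> u)
    finally show "lyap_norm A \<alpha> n (G_op A \<alpha> u n) \<le> (exp \<alpha> + 1) * c00_norm A \<alpha> u"
      using u by (simp add: G_op_def T_op_def distrib_right)
  qed
  show "G_op A \<alpha> (\<lambda>n. c *\<^sub>R u n) = (\<lambda>n. c *\<^sub>R G_op A \<alpha> u n)" for c
    using T u c00_scaleR[OF \<alpha> u, of c] by (auto simp: G_op_def fun_eq_iff scaleR_diff_right)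
  fix v assume v: "v \<in> c00 A \<alpha>"
  show "G_op A \<alpha> (\<lambda>n. u n + v n) = (\<lambda>n. G_op A \<alpha> u n + G_op A \<alpha> v n)"
    using T u v c00_add[OF \<alpha> u v] by (auto simp: G_op_def fun_eq_iff algebra_simps)
qed

end

theory Submission
  imports Defs
begin

text \<open>
  If \<open>\<alpha> < 0\<close> is admissible, then \<open>T\<^sub>\<alpha>\<close> is a strict contraction of \<open>c\<^sub>0\<^sub>0(\<alpha>)\<close>, so \<open>G\<^sub>\<alpha>\<close> is
  invertible. Conversely, let \<open>K\<close> bound the inverse of \<open>G\<^sub>\<alpha>\<close>. For \<open>1 \<le> n \<le> N\<close> the sequence with
  \<open>u\<^sub>k = e\<^bsup>\<nu>(k-n)\<^esup> A(k,n) x\<close> on \<open>n \<le> k \<le> N\<close>, zero before \<open>n\<close> and continued by the evolution after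
  \<open>N\<close>, has an image under \<open>G\<^sub>\<alpha>\<close> with finite support, equal to \<open>-x\<close> at \<open>n\<close> and to
  \<open>(e\<^bsup>-\<nu>\<^esup> - 1) u\<^sub>k\<close> on \<open>n < k \<le> N\<close>. Hence \<open>\<parallel>u\<parallel> \<le> K (\<parallel>x\<parallel> + \<nu> \<parallel>u\<parallel>)\<close>, and for \<open>\<nu> = 1/(2K)\<close> this is
  \<open>\<parallel>u\<parallel> \<le> 2K \<parallel>x\<parallel>\<close>, uniformly in \<open>n\<close> and \<open>N\<close>; so \<open>-\<nu>\<close> is admissible.
\<close>

section \<open>Elementary facts on \<open>c00\<close> and \<open>G_op\<close>\<close>

lemma c00_zero: "u \<in> c00 A \<alpha> \<Longrightarrow> u 0 = 0"
  by (simp add: c00_def)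

lemma c00_norm_nonneg:
  assumes "\<alpha> \<in> admissible_exponents A" "u \<in> c00 A \<alpha>"
  shows "0 \<le> c00_norm A \<alpha> u"
  using lyap_norm_le_c00_norm[OF assms(2), of 0] lyap_norm_nonneg[OF assms(1), of 0 "u 0"]
  by linarith

text \<open>Admits the test sequence \<open>v\<close> of \<open>lyap_norm_evol_decay\<close> as an
  argument of the inverse.\<close>

lemma c00_finite_support:
  assumes "u 0 = 0" "\<And>k. k > N \<Longrightarrow> u k = 0"
  shows "u \<in> c00 A \<alpha>"
proof -
  have "\<forall>\<^sub>F k in sequentially. lyap_norm A \<alpha> k (u k) = 0"
    using eventually_gt_at_top[of N] by eventually_elim (simp add: assms(2))
  then show ?thesis
    using assms(1) by (simp add: c00_def tendsto_eventually)
qed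

lemma G_op_apply:
  assumes "u \<in> c00 A \<alpha>"
  shows "G_op A \<alpha> u k = (if k = 0 then 0 else A (k - 1) (u (k - 1))) - u k"
  using assms by (simp add: G_op_def T_op_def evolution_map_def)

section \<open>Scalar recursions with contraction factor \<open>q\<close>\<close>

text \<open>\<open>C / (1 - q)\<close> is the fixed point of t -> q t + C, so the bound reproduces
  itself at each step.\<close>

lemma one_step_recursion_le:
  fixes a b :: "nat \<Rightarrow> real"
  assumes q: "0 \<le> q" "q < 1" and step: "\<And>n. a (Suc n) \<le> q * a n + b (Suc n)"
    and a0: "a 0 \<le> C / (1 - q)" and b: "\<And>n. b n \<le> C"
  shows "a n \<le> C / (1 - q)"
proof (induction n)
  case (Suc n)
  have "a (Suc n) \<le> q * (C / (1 - q)) + C"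
    using step[of n] mult_left_mono[OF Suc q(1)] b[of "Suc n"] by linarith
  also have "\<dots> = C / (1 - q)"
    using q by (simp add: field_simps)
  finally show ?case .
qed (rule a0)

text \<open>Once \<open>b\<close> is small, its accumulated effect stays below a geometric sum,
  while the initial value is damped by powers of \<open>q\<close>.\<close>

lemma one_step_recursion_tendsto_0:
  fixes a b :: "nat \<Rightarrow> real"
  assumes q: "0 \<le> q" "q < 1" and step: "\<And>n. a (Suc n) \<le> q * a n + b (Suc n)"
    and a: "\<And>n. 0 \<le> a n" and b: "b \<longlonglongrightarrow> 0"
  shows "a \<longlonglongrightarrow> 0"
proof (rule LIMSEQ_I)
  fix e :: real
  assume e: "0 < e"
  \<comment> \<open>With this choice q (e/2) + d = e/2, so the summand \<open>e / 2\<close> is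
    invariant in the induction below.\<close>
  define d where "d = e * (1 - q) / 2"
  have d: "0 < d" using e q by (simp add: d_def)
  from order_tendstoD(2)[OF b d] obtain N where N: "\<And>n. n \<ge> N \<Longrightarrow> b n < d"
    by (auto simp: eventually_sequentially)
  have bound: "a (N + j) \<le> q ^ j * a N + e / 2" for j
  proof (induction j)
    case 0
    then show ?case using e by simp
  next
    case (Suc j)
    have "a (N + Suc j) \<le> q * (q ^ j * a N + e / 2) + d"
      using step[of "N + j"] mult_left_mono[OF Suc q(1)] N[of "Suc (N + j)"] by simp
    also have "\<dots> = q ^ Suc j * a N + e / 2"
      by (simp add: d_def field_simps)
    finally show ?case .
  qed
  have "(\<lambda>j. q ^ j * a N) \<longlonglongrightarrow> 0"
    using q by (intro tendsto_mult_left_zero LIMSEQ_power_zero) simp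
  from order_tendstoD(2)[OF this, of "e / 2"] e
  obtain J where J: "\<And>j. j \<ge> J \<Longrightarrow> q ^ j * a N < e / 2"
    by (auto simp: eventually_sequentially)
  have "norm (a n - 0) < e" if n: "n \<ge> N + J" for n
  proof -
    have "J \<le> n - N" using n by linarith
    from J[OF this] bound[of "n - N"] a[of n] n show ?thesis by simp
  qed
  then show "\<exists>n0. \<forall>n\<ge>n0. norm (a n - 0) < e" by blast
qed

section \<open>The inverse of \<open>G_op\<close> for a negative exponent\<close>

text \<open>Forward solution u of A(n) u(n) - u(n+1) = v(n+1). In closed form it is minus the sum of
  A(n,k) v(k) over k <= n, that is, minus the Neumann series of the evolution map. On
  \<open>c00\<close> the initial value is 0.\<close>

fun G_inverse :: "(nat \<Rightarrow> 'a::real_normed_vector \<Rightarrow>\<^sub>L 'a) \<Rightarrow> (nat \<Rightarrow> 'a) \<Rightarrow> nat \<Rightarrow> 'a" where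
  "G_inverse A v 0 = - v 0"
| "G_inverse A v (Suc n) = A n (G_inverse A v n) - v (Suc n)"

text \<open>Brings the inverse into the form of the scalar recursions, with
  \<open>q = exp \<alpha>\<close>; this is below 1 exactly when \<alpha> is negative.\<close>

lemma lyap_norm_G_inverse_step:
  assumes "\<alpha> \<in> admissible_exponents A"
  shows "lyap_norm A \<alpha> (Suc n) (G_inverse A v (Suc n))
    \<le> exp \<alpha> * lyap_norm A \<alpha> n (G_inverse A v n) + lyap_norm A \<alpha> (Suc n) (v (Suc n))"
  using lyap_norm_triangle[OF assms, of "Suc n" "A n (G_inverse A v n)" "- v (Suc n)"]
    lyap_norm_step[OF assms, of n "G_inverse A v n"]
  by (simp add: lyap_norm_minus)

lemma G_inverse_c00:
  assumes \<alpha>: "\<alpha> \<in> admissible_exponents A" "\<alpha> < 0" and v: "v \<in> c00 A \<alpha>"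
  shows "G_inverse A v \<in> c00 A \<alpha>"
proof -
  have "(\<lambda>n. lyap_norm A \<alpha> n (G_inverse A v n)) \<longlonglongrightarrow> 0"
    by (rule one_step_recursion_tendsto_0[where q = "exp \<alpha>" and b = "\<lambda>n. lyap_norm A \<alpha> n (v n)"])
       (use \<alpha> v lyap_norm_G_inverse_step[OF \<alpha>(1)] in
         \<open>auto simp: c00_def lyap_norm_nonneg simp del: G_inverse.simps\<close>)
  then show ?thesis
    using v by (simp add: c00_def)
qed

lemma c00_norm_G_inverse_le:
  assumes \<alpha>: "\<alpha> \<in> admissible_exponents A" "\<alpha> < 0" and v: "v \<in> c00 A \<alpha>"
  shows "c00_norm A \<alpha> (G_inverse A v) \<le> c00_norm A \<alpha> v / (1 - exp \<alpha>)"
proof (rule c00_norm_leI)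
  show "lyap_norm A \<alpha> n (G_inverse A v n) \<le> c00_norm A \<alpha> v / (1 - exp \<alpha>)" for n
    by (rule one_step_recursion_le[where b = "\<lambda>n. lyap_norm A \<alpha> n (v n)"])
       (use \<alpha> v lyap_norm_G_inverse_step[OF \<alpha>(1)] in
         \<open>auto simp: c00_zero c00_norm_nonneg lyap_norm_le_c00_norm simp del: G_inverse.simps(2)\<close>)
qed

lemma G_inverse_G_op:
  assumes "u \<in> c00 A \<alpha>"
  shows "G_inverse A (G_op A \<alpha> u) = u"
proof
  show "G_inverse A (G_op A \<alpha> u) n = u n" for n
    by (induction n) (simp_all add: G_op_apply[OF assms])
qed

lemma G_op_G_inverse:
  assumes "G_inverse A v \<in> c00 A \<alpha>" and "v \<in> c00 A \<alpha>"
  shows "G_op A \<alpha> (G_inverse A v) = v"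
proof
  show "G_op A \<alpha> (G_inverse A v) n = v n" for n
    by (cases n) (simp_all add: G_op_apply[OF assms(1)] c00_zero[OF assms(2)])
qed

lemma G_inverse_add: "G_inverse A (\<lambda>k. u k + v k) n = G_inverse A u n + G_inverse A v n"
  by (induction n) (simp_all add: blinfun.add_right)

lemma G_inverse_scaleR: "G_inverse A (\<lambda>k. c *\<^sub>R u k) n = c *\<^sub>R G_inverse A u n"
  by (induction n) (simp_all add: blinfun.scaleR_right scaleR_diff_right)

lemma invertible_G_op:
  assumes \<alpha>: "\<alpha> \<in> admissible_exponents A" "\<alpha> < 0"
  shows "invertible_operator_on (c00 A \<alpha>) (c00_norm A \<alpha>) (G_op A \<alpha>)"
proof -
  have "c00_norm A \<alpha> (G_inverse A v) \<le> 1 / (1 - exp \<alpha>) * c00_norm A \<alpha> v" if "v \<in> c00 A \<alpha>" for v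
    using c00_norm_G_inverse_le[OF \<alpha> that] by simp
  then have "bounded_operator_on (c00 A \<alpha>) (c00_norm A \<alpha>) (G_inverse A)"
    unfolding bounded_operator_on_def
    by (intro conjI exI[of _ "1 / (1 - exp \<alpha>)"])
       (auto simp: G_inverse_add G_inverse_scaleR G_inverse_c00[OF \<alpha>])
  then show ?thesis
    unfolding invertible_operator_on_def
    using bounded_operator_G_op[OF \<alpha>(1)] G_inverse_G_op G_op_G_inverse G_inverse_c00[OF \<alpha>]
    by metis
qed

section \<open>Exponential decay from a bounded inverse\<close>

lemma lyap_norm_evol_decay:
  assumes \<alpha>: "\<alpha> \<in> admissible_exponents A"
    and S_c00: "\<And>v. v \<in> c00 A \<alpha> \<Longrightarrow> S v \<in> c00 A \<alpha>"
    and GS: "\<And>v. v \<in> c00 A \<alpha> \<Longrightarrow> G_op A \<alpha> (S v) = v"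
    and S_le: "\<And>v. v \<in> c00 A \<alpha> \<Longrightarrow> c00_norm A \<alpha> (S v) \<le> K * c00_norm A \<alpha> v"
    and K: "0 < K" and n: "0 < n" "n \<le> N"
  shows "lyap_norm A \<alpha> N (evol A N n x)
    \<le> 2 * K * exp (- (1 / (2 * K)) * (real N - real n)) * lyap_norm A \<alpha> n x"
proof -
  define \<nu> where "\<nu> = 1 / (2 * K)"
  define w where "w k = exp (\<nu> * (real k - real n)) *\<^sub>R evol A k n x" for k
  \<comment> \<open>The weighted orbit \<open>w\<close> misses being an orbit by the factor
    \<open>exp (- \<nu>)\<close> per step; \<open>v\<close> supplies the difference up to time
    \<open>N\<close>.\<close>
  define v where "v k = (if k = n then - x
      else if n < k \<and> k \<le> N then (exp (- \<nu>) - 1) *\<^sub>R w k else 0)" for k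
  \<comment> \<open>Defining \<open>u\<close> through \<open>S\<close> gives membership in
    \<open>c00\<close> at once, without examining the tail after \<open>N\<close>; the recursion
    then identifies \<open>u\<close> with \<open>w\<close> between \<open>n\<close> and
    \<open>N\<close>.\<close>
  define u where "u = S v"
  have v: "v \<in> c00 A \<alpha>"
    by (rule c00_finite_support[of _ N]) (use n in \<open>auto simp: v_def\<close>)
  have u: "u \<in> c00 A \<alpha>"
    unfolding u_def by (rule S_c00[OF v])
  have rec: "u (Suc k) = A k (u k) - v (Suc k)" for k
    using fun_cong[OF GS[OF v], of "Suc k"] G_op_apply[OF u, of "Suc k"]
    by (simp add: u_def algebra_simps)
  have w_Suc: "A k (w k) = exp (- \<nu>) *\<^sub>R w (Suc k)" if "n \<le> k" for k
    using that by (simp add: w_def blinfun.scaleR_right exp_add[symmetric] algebra_simps)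
  have u_before: "u k = 0" if "k < n" for k
    using that by (induction k) (use u rec in \<open>auto simp: c00_zero v_def\<close>)
  have u_eq: "u k = w k" if "n \<le> k" "k \<le> N" for k
    using that
  proof (induction k rule: dec_induct)
    case base
    then show ?case
      \<comment> \<open>As \<open>n\<close> is positive, there is a preceding index;
        \<open>u\<close> vanishes there, so \<open>u n\<close> is \<open>- v n\<close>, which is
        \<open>x\<close>.\<close>
      using n rec[of "n - 1"] u_before[of "n - 1"] by (simp add: v_def w_def)
  next
    case (step k)
    then have "u (Suc k) = exp (- \<nu>) *\<^sub>R w (Suc k) - (exp (- \<nu>) - 1) *\<^sub>R w (Suc k)"
      by (simp add: rec v_def w_Suc)
    then show ?case by (simp add: algebra_simps)
  qed
  let ?x = "lyap_norm A \<alpha> n x" and ?u = "c00_norm A \<alpha> u"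
  have \<nu>: "0 < \<nu>" using K by (simp add: \<nu>_def)
  have x0: "0 \<le> ?x" and u0: "0 \<le> ?u"
    using lyap_norm_nonneg[OF \<alpha>] c00_norm_nonneg[OF \<alpha> u] by auto
  have "c00_norm A \<alpha> v \<le> ?x + \<nu> * ?u"
  proof (rule c00_norm_leI)
    fix k
    consider "k = n" | "n < k" "k \<le> N" | "v k = 0" by (force simp: v_def)
    then show "lyap_norm A \<alpha> k (v k) \<le> ?x + \<nu> * ?u"
    proof cases
      case 1
      then show ?thesis using \<nu> u0 by (simp add: v_def lyap_norm_minus)
    next
      case 2
      then have "v k = (exp (- \<nu>) - 1) *\<^sub>R u k" by (simp add: v_def u_eq)
      then have "lyap_norm A \<alpha> k (v k) \<le> \<bar>exp (- \<nu>) - 1\<bar> * lyap_norm A \<alpha> k (u k)"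
        using lyap_norm_scaleR_le[OF \<alpha>] by simp
      also have "\<dots> \<le> \<nu> * ?u"
      proof (intro mult_mono lyap_norm_le_c00_norm[OF u] lyap_norm_nonneg[OF \<alpha>])
        show "\<bar>exp (- \<nu>) - 1\<bar> \<le> \<nu>"
          using exp_ge_add_one_self[of "- \<nu>"] \<nu> by (simp add: abs_if)
      qed (use \<nu> in simp)
      finally show ?thesis using x0 by simp
    next
      case 3
      then show ?thesis using \<nu> u0 x0 by simp
    qed
  qed
  then have "?u \<le> K * (?x + \<nu> * ?u)"
    using order_trans[OF S_le[OF v] mult_left_mono] K by (simp add: u_def)
  also have "\<dots> = K * ?x + ?u / 2"
    using K by (simp add: \<nu>_def field_simps)
  \<comment> \<open>The half of \<open>?u\<close> on the right is absorbed on the left.\<close>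
  finally have u_le: "?u \<le> 2 * K * ?x" by simp
  have "evol A N n x = exp (- \<nu> * (real N - real n)) *\<^sub>R u N"
    using n by (simp add: u_eq w_def exp_add[symmetric])
  then have "lyap_norm A \<alpha> N (evol A N n x)
      \<le> exp (- \<nu> * (real N - real n)) * lyap_norm A \<alpha> N (u N)"
    using lyap_norm_scaleR_le[OF \<alpha>, of N "exp (- \<nu> * (real N - real n))" "u N"] by simp
  also have "\<dots> \<le> exp (- \<nu> * (real N - real n)) * (2 * K * ?x)"
    using lyap_norm_le_c00_norm[OF u, of N] u_le by (intro mult_left_mono) auto
  finally show ?thesis by (simp add: \<nu>_def mult_ac)
qed

text \<open>Sequences in \<open>c00\<close> vanish at 0, so the decay argument starts only at
  positive times. Time 0 is recovered from A(m,0) = A(m,1) A(0), at the cost of a larger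
  constant.\<close>

lemma admissible_exponent_from_positive_times:
  assumes C: "\<And>n. 0 < n \<Longrightarrow> 0 < C n"
    and le: "\<And>m n. 0 < n \<Longrightarrow> n \<le> m \<Longrightarrow> norm (evol A m n) \<le> C n * exp (\<beta> * (real m - real n))"
  shows "\<beta> \<in> admissible_exponents A"
proof -
  \<comment> \<open>The factor \<open>exp (- \<beta>)\<close> pays for the step from 0 to 1; the
    summand 1 covers \<open>m = 0\<close> and keeps \<open>M 0\<close> positive even if
    \<open>A 0\<close> is zero.\<close>
  define M where "M n = (if n = 0 then 1 + C 1 * exp (- \<beta>) * norm (A 0) else C n)" for n
  have M0: "0 \<le> C 1 * exp (- \<beta>) * norm (A 0)"
    using C[of 1] by simp
  have "norm (evol A m 0) \<le> M 0 * exp (\<beta> * real m)" for m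
  proof (cases "m = 0")
    case True
    then show ?thesis
      using norm_blinfun_id_le[where 'a = 'a] M0 by (simp add: M_def)
  next
    case False
    have "norm (evol A m 0) \<le> norm (evol A m 1) * norm (A 0)"
      using evol_right[of 0 m A] False norm_blinfun_compose[of "evol A m 1" "A 0"] by simp
    also have "\<dots> \<le> C 1 * exp (\<beta> * (real m - 1)) * norm (A 0)"
      using le[of 1 m] False by (intro mult_right_mono) auto
    also have "\<dots> = (C 1 * exp (- \<beta>) * norm (A 0)) * exp (\<beta> * real m)"
      by (simp add: algebra_simps exp_diff exp_minus field_simps)
    also have "\<dots> \<le> M 0 * exp (\<beta> * real m)"
      by (simp add: M_def)
    finally show ?thesis .
  qed
  then have "norm (evol A m n) \<le> M n * exp (\<beta> * (real m - real n))" if "n \<le> m" for m n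
    using le[OF _ that] by (cases "n = 0") (auto simp: M_def)
  moreover have "0 < M n" for n
    using C[of n] M0 by (simp add: M_def)
  ultimately show ?thesis
    unfolding admissible_exponents_def by blast
qed

lemma nonuniform_exp_stable_if_invertible:
  assumes \<alpha>: "\<alpha> \<in> admissible_exponents A"
    and inv: "invertible_operator_on (c00 A \<alpha>) (c00_norm A \<alpha>) (G_op A \<alpha>)"
  shows "nonuniform_exp_stable A"
proof -
  obtain S K0 where S: "\<And>v. v \<in> c00 A \<alpha> \<Longrightarrow> S v \<in> c00 A \<alpha>"
      "\<And>v. v \<in> c00 A \<alpha> \<Longrightarrow> G_op A \<alpha> (S v) = v"
    and K0: "\<And>v. v \<in> c00 A \<alpha> \<Longrightarrow> c00_norm A \<alpha> (S v) \<le> K0 * c00_norm A \<alpha> v"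
    using inv unfolding invertible_operator_on_def bounded_operator_on_def by metis
  \<comment> \<open>\<open>K0\<close> may fail to be positive, whereas the new exponent divides by
    \<open>K\<close>.\<close>
  define K where "K = max K0 1"
  have K: "0 < K" by (simp add: K_def)
  have S_le: "c00_norm A \<alpha> (S v) \<le> K * c00_norm A \<alpha> v" if v: "v \<in> c00 A \<alpha>" for v
    using K0[OF v] mult_right_mono[of K0 K, OF _ c00_norm_nonneg[OF \<alpha> v]] by (simp add: K_def)
  obtain M where M: "\<And>n. 0 < M n"
    "\<And>m n. n \<le> m \<Longrightarrow> norm (evol A m n) \<le> M n * exp (\<alpha> * (real m - real n))"
    using \<alpha> unfolding admissible_exponents_def by auto
  have "- (1 / (2 * K)) \<in> admissible_exponents A"
  proof (rule admissible_exponent_from_positive_times[where C = "\<lambda>n. 2 * K * M n"])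
    show "0 < 2 * K * M n" for n using K M(1) by simp
    fix m n :: nat
    assume n: "0 < n" "n \<le> m"
    let ?e = "exp (- (1 / (2 * K)) * (real m - real n))"
    show "norm (evol A m n) \<le> 2 * K * M n * ?e"
    proof (rule norm_blinfun_bound)
      fix x
      \<comment> \<open>Passing to the Lyapunov norm at time \<open>m\<close> costs no constant, and
        returning at time \<open>n\<close> costs \<open>M n\<close>; hence the final constant
        depends on \<open>n\<close> alone.\<close>
      have "norm (evol A m n x) \<le> lyap_norm A \<alpha> m (evol A m n x)"
        by (rule norm_le_lyap_norm[OF \<alpha>])
      also have "\<dots> \<le> 2 * K * ?e * lyap_norm A \<alpha> n x"
        by (rule lyap_norm_evol_decay[where S = S, OF \<alpha> S S_le K n])
      also have "\<dots> \<le> 2 * K * ?e * (M n * norm x)"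
        using K by (intro mult_left_mono lyap_norm_leI lyap_term_le M(2)) auto
      finally show "norm (evol A m n x) \<le> 2 * K * M n * ?e * norm x"
        by (simp add: mult_ac)
    qed (use K M(1)[of n] in simp)
  qed
  then show ?thesis
    using K unfolding nonuniform_exp_stable_def by force
qed

theorem theorem3p1:
  fixes A :: "nat \<Rightarrow> 'a::banach \<Rightarrow>\<^sub>L 'a"
  assumes "admissible_exponents A \<noteq> {}"
  shows "nonuniform_exp_stable A \<longleftrightarrow>
    (\<exists>\<alpha>\<in>admissible_exponents A.
       invertible_operator_on (c00 A \<alpha>) (c00_norm A \<alpha>) (G_op A \<alpha>))"
  using invertible_G_op nonuniform_exp_stable_if_invertible
  unfolding nonuniform_exp_stable_def by blast

end
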